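(* Let $V$ be a market model (normal integrand form). If $V$ satisfies the no-arbitrage condition (NA), then the set of superhedgeable claims $$\mathcal C=\{g\in L^0(\mathcal F;\mathbb R) : \exists\,\vartheta\in\mathcal A \text{ with } V(\vartheta)\ge g \text{ a.s.}\}$$ is closed in probability, i.e. closed in $L^0(\mathcal F;\mathbb R)$ under convergence in probability.
   Context: $(\Omega,\mathcal F,\mathbb P)$ is a probability space with a filtration $(\mathcal F_t)_{t=0,\dots,T}$, $\mathcal F_t\subseteq\mathcal F$. The set of strategies is $\mathcal A=\{(\vartheta_0,\dots,\vartheta_{T-1}) : \vartheta_t\in L^0(\Omega,\mathcal F_t,\mathbb P;\mathbb R^d)\ \forall t\}$, identified a.s. and regarded as $\mathbb R^{dT}$-valued random vectors. A market model (in normal integrand form) is a mapping $V:\Omega\times\mathbb R^{dT}\to\mathbb R\cup\{-\infty\}$ with $V(\cdot,0)=0$ a.s. which is an $\mathcal F$ normal integrand: the set-valued map $\omega\mapsto\{(x,r)\in\mathbb R^{dT}\times\mathbb R : r\le V(\omega,x)\}$ is closed-valued and $\mathcal F$ measurable (the set of $\omega$ for which it meets a given open ball is in $\mathcal F$). For a random vector $\vartheta$, $V(\vartheta)$ denotes $\omega\mapsto V(\omega,\vartheta(\omega))$. The recession market model is $$V^\infty(\omega,z)=\lim_{\lambda\to\infty}\ \sup_{\delta>\lambda,\ |x-z|<1/\lambda}\ \tfrac1\delta V(\omega,\delta x)\in\mathbb R\cup\{\pm\infty\}.$$ $V$ satisfies the no-arbitrage condition (NA) if $\{\vartheta\in\mathcal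 A : V^\infty(\vartheta)\ge 0\text{ a.s.}\}=\{0\}$. *)

theory Defs
  imports "HOL-Probability.Probability"
begin

text \<open>
  The horizon \<open>T\<close> and the number of assets \<open>d\<close> are arbitrary but fixed. The space of
  \<open>dT\<close>-dimensional real vectors is the type \<open>(real^'d)^'t\<close> with \<open>d = CARD('d)\<close> and
  \<open>T = CARD('t)\<close>; its norm is the Euclidean one. The trading dates \<open>'t\<close> form a finite linear
  order, which \<open>date\<close> identifies with \<open>{0, \<dots>, T - 1}\<close>.
\<close>

definition date :: "'t::{finite,linorder} \<Rightarrow> nat" where
  "date t = card {s. s < t}"

lemma date_strict_mono: "strict_mono (date :: 't::{finite,linorder} \<Rightarrow> nat)"
proof (rule strict_monoI)
  fix s t :: 't
  assume "s < t"
  then have "{u. u < s} \<subset> {u. u < t}" by force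
  then show "date s < date t" unfolding date_def by (intro psubset_card_mono) auto
qed

lemma date_bij_betw: "bij_betw (date :: 't::{finite,linorder} \<Rightarrow> nat) UNIV {..<CARD('t)}"
proof -
  have inj: "inj (date :: 't \<Rightarrow> nat)"
    using date_strict_mono by (rule strict_mono_imp_inj_on)
  have "date t < CARD('t)" for t :: 't
    unfolding date_def by (intro psubset_card_mono) auto
  then have "range (date :: 't \<Rightarrow> nat) \<subseteq> {..<CARD('t)}" by auto
  moreover have "card (range (date :: 't \<Rightarrow> nat)) = card {..<CARD('t)}"
    using inj by (simp add: card_image)
  ultimately have "range (date :: 't \<Rightarrow> nat) = {..<CARD('t)}"
    by (intro card_subset_eq) auto
  with inj show ?thesis by (simp add: bij_betw_def)
qed

definition filtration_upto :: "'w measure \<Rightarrow> nat \<Rightarrow> (nat \<Rightarrow> 'w measure) \<Rightarrow> bool" where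
  "filtration_upto M T F \<longleftrightarrow>
     (\<forall>t\<le>T. subalgebra M (F t)) \<and> (\<forall>s t. s \<le> t \<and> t \<le> T \<longrightarrow> sets (F s) \<subseteq> sets (F t))"

text \<open>
  Random variables are represented by measurable functions; the almost sure identification in
  \<open>L\<^sup>0\<close> is made explicit by \<open>AE\<close> wherever two of them are compared.
\<close>

definition strategies ::
  "(nat \<Rightarrow> 'w measure) \<Rightarrow> ('w \<Rightarrow> (real^'d)^('t::{finite,linorder})) set" where
  "strategies F = {\<theta>. \<forall>t. (\<lambda>\<omega>. \<theta> \<omega> $ t) \<in> borel_measurable (F (date t))}"

definition hypograph :: "('e \<Rightarrow> ereal) \<Rightarrow> ('e \<times> real) set" where
  "hypograph f = {(x, r). ereal r \<le> f x}"

definition normal_integrand :: "'w measure \<Rightarrow> ('w \<Rightarrow> 'e::euclidean_space \<Rightarrow> ereal) \<Rightarrow> bool" where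
  "normal_integrand M V \<longleftrightarrow>
     (\<forall>\<omega>\<in>space M. closed (hypograph (V \<omega>))) \<and>
     (\<forall>c \<epsilon>. {\<omega>\<in>space M. hypograph (V \<omega>) \<inter> ball c \<epsilon> \<noteq> {}} \<in> sets M)"

definition market_model :: "'w measure \<Rightarrow> ('w \<Rightarrow> 'e::euclidean_space \<Rightarrow> ereal) \<Rightarrow> bool" where
  "market_model M V \<longleftrightarrow>
     (\<forall>\<omega>\<in>space M. \<forall>x. V \<omega> x \<noteq> \<infinity>) \<and> (AE \<omega> in M. V \<omega> 0 = 0) \<and> normal_integrand M V"

definition recession :: "('w \<Rightarrow> 'e::euclidean_space \<Rightarrow> ereal) \<Rightarrow> 'w \<Rightarrow> 'e \<Rightarrow> ereal" where
  "recession V \<omega> z =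
     Lim at_top (\<lambda>l::real.
       SUP (\<delta>, x) \<in> {(\<delta>, x). \<delta> > l \<and> norm (x - z) < 1 / l}. ereal (1 / \<delta>) * V \<omega> (\<delta> *\<^sub>R x))"

text \<open>The limit in the definition of \<open>recession\<close> always exists, by monotonicity.\<close>

lemma recession_tendsto:
  "((\<lambda>l::real. SUP (\<delta>, x) \<in> {(\<delta>, x). \<delta> > l \<and> norm (x - z) < 1 / l}.
       ereal (1 / \<delta>) * V \<omega> (\<delta> *\<^sub>R x)) \<longlongrightarrow> recession V \<omega> z) at_top"
proof -
  define f :: "real \<Rightarrow> ereal" where
    "f l = (SUP (\<delta>, x) \<in> {(\<delta>, x). \<delta> > l \<and> norm (x - z) < 1 / l}.
       ereal (1 / \<delta>) * V \<omega> (\<delta> *\<^sub>R x))" for l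
  have anti: "f m \<le> f l" if "0 < l" "l \<le> m" for l m
    unfolding f_def
  proof (rule SUP_subset_mono)
    have "1 / m \<le> 1 / l" using that by (simp add: frac_le)
    then show "{(\<delta>, x). \<delta> > m \<and> norm (x - z) < 1 / m} \<subseteq> {(\<delta>, x). \<delta> > l \<and> norm (x - z) < 1 / l}"
      using that by auto
  qed simp
  have "(f \<longlongrightarrow> (INF l\<in>{0<..}. f l)) at_top"
  proof (rule order_tendstoI)
    fix a assume "a < (INF l\<in>{0<..}. f l)"
    then have "a < f l" if "0 < l" for l
      using that by (meson INF_lower greaterThan_iff less_le_trans)
    then show "\<forall>\<^sub>F l in at_top. a < f l"
      by (intro eventually_mono[OF eventually_gt_at_top[of 0]])
  next
    fix a assume "(INF l\<in>{0<..}. f l) < a"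
    then obtain l where l: "0 < l" "f l < a" by (auto simp: INF_less_iff)
    then show "\<forall>\<^sub>F m in at_top. f m < a"
      by (intro eventually_mono[OF eventually_ge_at_top[of l]]) (use anti le_less_trans in blast)
  qed
  then have "(f \<longlongrightarrow> Lim at_top f) at_top"
    by (metis tendsto_Lim trivial_limit_at_top_linorder)
  then show ?thesis unfolding recession_def f_def .
qed

definition NA ::
  "'w measure \<Rightarrow> (nat \<Rightarrow> 'w measure) \<Rightarrow> ('w \<Rightarrow> (real^'d)^('t::{finite,linorder}) \<Rightarrow> ereal) \<Rightarrow> bool"
where
  "NA M F V \<longleftrightarrow>
     (\<forall>\<theta>\<in>strategies F. (AE \<omega> in M. recession V \<omega> (\<theta> \<omega>) \<ge> 0) \<longleftrightarrow> (AE \<omega> in M. \<theta> \<omega> = 0))"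

definition superhedgeable ::
  "'w measure \<Rightarrow> (nat \<Rightarrow> 'w measure) \<Rightarrow> ('w \<Rightarrow> (real^'d)^('t::{finite,linorder}) \<Rightarrow> ereal) \<Rightarrow>
     ('w \<Rightarrow> real) set"
where
  "superhedgeable M F V =
     {g \<in> borel_measurable M. \<exists>\<theta>\<in>strategies F. AE \<omega> in M. V \<omega> (\<theta> \<omega>) \<ge> ereal (g \<omega>)}"

definition tendsto_in_probability ::
  "'w measure \<Rightarrow> (nat \<Rightarrow> 'w \<Rightarrow> real) \<Rightarrow> ('w \<Rightarrow> real) \<Rightarrow> bool" where
  "tendsto_in_probability M X Y \<longleftrightarrow>
     (\<forall>\<epsilon>>0. (\<lambda>n. measure M {\<omega>\<in>space M. \<bar>X n \<omega> - Y \<omega>\<bar> > \<epsilon>}) \<longlonglongrightarrow> 0)"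

text \<open>
  Convergence in probability is induced by a pseudometric, so closedness is sequential closedness.
\<close>

definition closed_in_probability :: "'w measure \<Rightarrow> ('w \<Rightarrow> real) set \<Rightarrow> bool" where
  "closed_in_probability M C \<longleftrightarrow>
     (\<forall>X. \<forall>Y\<in>borel_measurable M.
        (\<forall>n. X n \<in> C) \<and> tendsto_in_probability M X Y \<longrightarrow> Y \<in> C)"

end

theory Submission
  imports Defs
begin

text \<open>
  Take strategies hedging a sequence of claims that converges almost surely along a subsequence,
  and list their \<open>N = dT\<close> scalar coordinates \<open>a\<^sub>0, \<dots>, a\<^bsub>N - 1\<^esub>\<close> chronologically. With
  \<open>r\<^sub>j = 1 + \<bar>a\<^sub>0\<bar> + \<dots> + \<bar>a\<^bsub>j - 1\<^esub>\<bar>\<close> the ratios \<open>u\<^sub>j = a\<^sub>j / r\<^bsub>j + 1\<^esub>\<close> are adapted and lie in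
  \<open>[-1, 1]\<close>, and successive conditional lower limits give an adapted \<open>l\<close> that is pointwise a joint
  cluster point of the \<open>u\<^sub>j\<close>. Since \<open>r\<^sub>j / r\<^bsub>j + 1\<^esub> = 1 - \<bar>u\<^sub>j\<bar>\<close>, the coordinate \<open>a\<^sub>t\<close> dominates all earlier
  ones exactly where \<open>\<bar>l\<^sub>t\<bar> = 1\<close>. If this has probability zero for all later coordinates, then on
  \<open>\<bar>l\<^sub>t\<bar> = 1\<close> the strategies divided by \<open>r\<^bsub>t + 1\<^esub>\<close> cluster at a vector whose coordinates before \<open>t\<close>
  vanish; set to zero elsewhere, it is an adapted strategy with nonnegative recession value and
  \<open>t\<close>-th coordinate \<open>\<plusminus>1\<close>, so (NA) forces \<open>\<bar>l\<^sub>t\<bar> < 1\<close> almost surely. By downward induction no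
  coordinate explodes, the strategies themselves cluster at an adapted strategy, and upper
  semicontinuity of \<open>V\<close> shows that it hedges the limit claim. The random subsequence realising the
  cluster point need not be adapted; only its limit must be.
\<close>

section \<open>Almost sure subsequences, recession and upper semicontinuity\<close>

lemma tendsto_in_probability_AE_subseq:
  assumes "prob_space M"
    and X [measurable]: "\<And>n. X n \<in> borel_measurable M"
    and Y [measurable]: "Y \<in> borel_measurable M"
    and lim: "tendsto_in_probability M X Y"
  obtains \<psi> :: "nat \<Rightarrow> nat" where "AE \<omega> in M. (\<lambda>n. X (\<psi> n) \<omega>) \<longlonglongrightarrow> Y \<omega>"
proof -
  interpret prob_space M by fact
  define A where "A n \<epsilon> = {\<omega>\<in>space M. \<bar>X n \<omega> - Y \<omega>\<bar> > \<epsilon>}" for n \<epsilon>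
  have A [measurable]: "A n \<epsilon> \<in> sets M" for n \<epsilon> unfolding A_def by measurable
  \<comment> \<open>Threshold and probability bound are both \<open>(1/2)^k\<close>: the bounds are
    summable, so Borel-Cantelli applies, and the thresholds tend to 0.\<close>
  have "\<exists>n. measure M (A n ((1/2)^k)) < (1/2)^k" for k :: nat
  proof -
    have "(\<lambda>n. measure M (A n ((1/2)^k))) \<longlonglongrightarrow> 0"
      using lim unfolding tendsto_in_probability_def A_def by simp
    then have "\<forall>\<^sub>F n in sequentially. measure M (A n ((1/2)^k)) < (1/2)^k"
      by (rule order_tendstoD) simp
    then show ?thesis by (auto simp: eventually_sequentially)
  qed
  then obtain \<psi> where \<psi>: "\<And>k. measure M (A (\<psi> k) ((1/2)^k)) < (1/2)^k" by metis
  have "summable (\<lambda>k. measure M (A (\<psi> k) ((1/2)^k)))"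
    by (rule summable_comparison_test'[of "\<lambda>k. (1/2::real)^k" 0])
      (use \<psi> less_imp_le in \<open>auto intro: summable_geometric\<close>)
  then have "AE \<omega> in M. \<forall>\<^sub>F k in sequentially. \<omega> \<in> space M - A (\<psi> k) ((1/2)^k)"
    by (intro borel_cantelli_AE1) (auto simp: emeasure_eq_measure)
  then have "AE \<omega> in M. (\<lambda>n. X (\<psi> n) \<omega>) \<longlonglongrightarrow> Y \<omega>"
  proof (rule AE_mp, intro AE_I2 impI)
    fix \<omega> assume "\<forall>\<^sub>F k in sequentially. \<omega> \<in> space M - A (\<psi> k) ((1/2)^k)"
    then have "\<forall>\<^sub>F k in sequentially. norm (X (\<psi> k) \<omega> - Y \<omega>) \<le> (1/2)^k"
      by eventually_elim (auto simp: A_def)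
    then have "(\<lambda>k. X (\<psi> k) \<omega> - Y \<omega>) \<longlonglongrightarrow> 0"
      by (rule Lim_null_comparison) (simp add: LIMSEQ_realpow_zero)
    then show "(\<lambda>n. X (\<psi> n) \<omega>) \<longlonglongrightarrow> Y \<omega>" by (simp add: LIM_zero_iff)
  qed
  then show thesis by (rule that)
qed

text \<open>For each \<open>l > 0\<close> the pair of \<open>\<delta> k\<close> and
  \<open>\<zeta> k\<close> eventually lies in the index set of the supremum, which is therefore at
  least \<open>c k / \<delta> k\<close>. In the main application the \<open>c k\<close> are
  convergent claims and the \<open>\<delta> k\<close> are exploding scales.\<close>

lemma recession_nonneg:
  fixes z :: "'e::euclidean_space"
  assumes \<delta>: "filterlim \<delta> at_top sequentially"
    and \<zeta>: "\<zeta> \<longlonglongrightarrow> z"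
    and V: "\<And>k. ereal (c k) \<le> V \<omega> (\<delta> k *\<^sub>R \<zeta> k)"
    and c: "(\<lambda>k. c k / \<delta> k) \<longlonglongrightarrow> 0"
  shows "0 \<le> recession V \<omega> z"
proof (rule tendsto_lowerbound[OF recession_tendsto])
  show "\<forall>\<^sub>F l in at_top. 0 \<le> (SUP (\<delta>, x) \<in> {(\<delta>, x). \<delta> > l \<and> norm (x - z) < 1 / l}.
       ereal (1 / \<delta>) * V \<omega> (\<delta> *\<^sub>R x))"
  proof (rule eventually_mono[OF eventually_gt_at_top[of 0]])
    fix l :: real assume "0 < l"
    let ?s = "SUP (\<delta>, x) \<in> {(\<delta>, x). \<delta> > l \<and> norm (x - z) < 1 / l}. ereal (1 / \<delta>) * V \<omega> (\<delta> *\<^sub>R x)"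
    have "\<forall>\<^sub>F k in sequentially. \<delta> k > l"
      using \<delta> by (auto simp: filterlim_at_top_dense)
    moreover have "\<forall>\<^sub>F k in sequentially. dist (\<zeta> k) z < 1 / l"
      using \<zeta> \<open>0 < l\<close> by (intro tendstoD) auto
    ultimately have "\<forall>\<^sub>F k in sequentially. ereal (c k / \<delta> k) \<le> ?s"
    proof eventually_elim
      case (elim k)
      have "ereal (c k / \<delta> k) = ereal (1 / \<delta> k) * ereal (c k)" by simp
      also have "\<dots> \<le> ereal (1 / \<delta> k) * V \<omega> (\<delta> k *\<^sub>R \<zeta> k)"
        using elim \<open>0 < l\<close> V by (intro ereal_mult_left_mono) auto
      also have "\<dots> \<le> ?s"
        using elim by (intro SUP_upper2[of "(\<delta> k, \<zeta> k)"]) (auto simp: dist_norm)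
      finally show ?case .
    qed
    moreover have "(\<lambda>k. ereal (c k / \<delta> k)) \<longlonglongrightarrow> 0"
      using c by (simp add: zero_ereal_def)
    ultimately show "0 \<le> ?s" by (intro tendsto_upperbound) auto
  qed
qed simp

lemma normal_integrand_usc:
  assumes "normal_integrand M V" "\<omega> \<in> space M"
    and "\<zeta> \<longlonglongrightarrow> z" "c \<longlonglongrightarrow> b" "\<And>k. ereal (c k) \<le> V \<omega> (\<zeta> k)"
  shows "ereal b \<le> V \<omega> z"
proof -
  have "closed (hypograph (V \<omega>))" using assms unfolding normal_integrand_def by auto
  moreover have "(\<zeta> k, c k) \<in> hypograph (V \<omega>)" for k
    using assms by (simp add: hypograph_def)
  moreover have "(\<lambda>k. (\<zeta> k, c k)) \<longlonglongrightarrow> (z, b)" using assms by (intro tendsto_Pair)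
  ultimately have "(z, b) \<in> hypograph (V \<omega>)" by (rule closed_sequentially)
  then show ?thesis by (simp add: hypograph_def)
qed

section \<open>Adapted cluster points\<close>

text \<open>The SUP-INF is the lower limit of \<open>a\<close> along the shrinking sets
  \<open>E k\<close>. The default 1 leaves the infimum over \<open>E k\<close> unchanged, as
  \<open>a\<close> is at most 1 and \<open>E k\<close> is nonempty; it keeps the index set fixed,
  which gives measurability once \<open>E\<close> is random.\<close>

lemma SUP_INF_cluster_point:
  fixes a :: "nat \<Rightarrow> real"
  assumes E: "decseq E" "\<And>k. E k \<noteq> {}" and a: "\<And>n. \<bar>a n\<bar> \<le> 1" and "0 < e"
  shows "\<exists>n\<in>E K. \<bar>a n - (SUP k. INF n. if n \<in> E k then a n else 1)\<bar> < e"
proof -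
  define b where "b k n = (if n \<in> E k then a n else 1)" for k n
  define m where "m k = (INF n. b k n)" for k
  define l where "l = (SUP k. m k)"
  have b_ge: "- 1 \<le> b k n" and b_le: "b k n \<le> 1" for k n
    using a[of n] by (auto simp: b_def)
  have bdd: "bdd_below (range (b k))" for k using b_ge by (intro bdd_belowI[of _ "-1"]) auto
  have m_le: "m k \<le> b k n" for k n unfolding m_def by (intro cINF_lower bdd) auto
  have bdd': "bdd_above (range m)"
    using order_trans[OF m_le b_le] by (intro bdd_aboveI[of _ 1]) auto
  have m_l: "m k \<le> l" for k unfolding l_def by (intro cSUP_upper bdd') auto
  have mono: "m k \<le> m k'" if "k \<le> k'" for k k'
    unfolding m_def[of k']
  proof (rule cINF_greatest)
    fix n
    have "b k n \<le> b k' n"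
      using decseqD[OF E(1) that] a[of n] by (auto simp: b_def)
    then show "m k \<le> b k' n" using m_le[of k n] by linarith
  qed simp
  have "l - e < (SUP k. m k)" using \<open>0 < e\<close> by (simp add: l_def)
  then obtain k where k: "l - e < m k" by (subst (asm) less_cSUP_iff) (auto intro: bdd')
  define k' where "k' = max k K"
  have "(INF n. b k' n) < m k' + e" using \<open>0 < e\<close> by (simp add: m_def)
  then obtain n where n: "b k' n < m k' + e"
    by (subst (asm) cINF_less_iff) (auto intro: bdd)
  \<comment> \<open>If the near-minimiser \<open>n\<close> only picks up the default, then
    \<open>1 < m k' + e\<close>, and any element of \<open>E k'\<close> will do.\<close>
  obtain n' where n': "n' \<in> E k'" "a n' < m k' + e"
  proof (cases "n \<in> E k'")
    case True then show ?thesis using that n by (auto simp: b_def)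
  next
    case False
    then have "1 < m k' + e" using n by (auto simp: b_def)
    moreover obtain n' where "n' \<in> E k'" using E(2) by blast
    ultimately show ?thesis using that[of n'] a[of n'] by linarith
  qed
  have "m k \<le> a n'" using mono[of k k'] m_le[of k' n'] n' by (auto simp: k'_def b_def)
  moreover have "n' \<in> E K" using decseqD[OF E(1), of K k'] n' by (auto simp: k'_def)
  moreover have "l = (SUP k. INF n. if n \<in> E k then a n else 1)"
    by (simp add: l_def m_def b_def)
  ultimately show ?thesis using k n' m_l[of k'] by (intro bexI[of _ n']) auto
qed

text \<open>Induction on \<open>N\<close>: the new limit is the lower limit of \<open>u N\<close>
  along those indices at which the earlier coordinates are close to their limits, already chosen. It
  depends on coordinates up to \<open>N\<close> only, hence is \<open>G N\<close>-measurable, and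
  the earlier limits stay as they are.\<close>

lemma adapted_cluster_point:
  fixes u :: "nat \<Rightarrow> nat \<Rightarrow> 'w \<Rightarrow> real"
  assumes G: "\<And>i j. i \<le> j \<Longrightarrow> j < N \<Longrightarrow> subalgebra (G j) (G i)"
    and u: "\<And>j n. j < N \<Longrightarrow> u j n \<in> borel_measurable (G j)"
    and bound: "\<And>j n \<omega>. \<bar>u j n \<omega>\<bar> \<le> 1"
  obtains l where "\<And>j. j < N \<Longrightarrow> l j \<in> borel_measurable (G j)"
    and "\<And>\<omega>. \<exists>\<phi>. filterlim \<phi> at_top sequentially \<and>
                 (\<forall>j<N. (\<lambda>k. u j (\<phi> k) \<omega>) \<longlonglongrightarrow> l j \<omega>)"
proof -
  have "\<exists>l. (\<forall>j<N. l j \<in> borel_measurable (G j)) \<and>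
      (\<forall>\<omega> k. \<exists>n\<ge>k. \<forall>j<N. \<bar>u j n \<omega> - l j \<omega>\<bar> < 1 / Suc k)"
    using G u
  proof (induction N)
    case 0
    then show ?case by auto
  next
    case (Suc N)
    then obtain l where l: "\<And>j. j < N \<Longrightarrow> l j \<in> borel_measurable (G j)"
      and cl: "\<And>\<omega> k. \<exists>n\<ge>k. \<forall>j<N. \<bar>u j n \<omega> - l j \<omega>\<bar> < 1 / Suc k"
      by (metis less_Suc_eq)
    \<comment> \<open>The condition \<open>k \<le> n\<close> drives the indices to infinity, and the
      shrinking tolerance makes the sets nested. For fixed \<open>n\<close> and \<open>k\<close>,
      membership is an event of \<open>G N\<close>.\<close>
    define E where "E \<omega> k = {n. k \<le> n \<and> (\<forall>j\<in>{..<N}. \<bar>u j n \<omega> - l j \<omega>\<bar> < 1 / Suc k)}" for \<omega> k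
    define y where "y \<omega> = (SUP k. INF n. if n \<in> E \<omega> k then u N n \<omega> else 1)" for \<omega>
    have meas: "l j \<in> borel_measurable (G N)" "u j n \<in> borel_measurable (G N)" if "j < N" for j n
      using that Suc.prems(2)[of j n] l[of j] measurable_from_subalg[OF Suc.prems(1)[of j N]] by auto
    have [measurable]: "u N n \<in> borel_measurable (G N)" for n using Suc.prems by auto
    have [measurable]: "Measurable.pred (G N) (\<lambda>\<omega>. n \<in> E \<omega> k)" for n k
    proof -
      have "Measurable.pred (G N) (\<lambda>\<omega>. \<forall>j\<in>{..<N}. \<bar>u j n \<omega> - l j \<omega>\<bar> < 1 / Suc k)"
        by (intro pred_intros_finite) (use meas in \<open>auto intro!: borel_measurable_pred_less\<close>)
      then show ?thesis
        unfolding E_def mem_Collect_eq by (intro pred_intros_logic) simp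
    qed
    have y: "y \<in> borel_measurable (G N)" unfolding y_def
    proof (rule borel_measurable_cSUP)
      fix \<omega>
      have "(INF n. if n \<in> E \<omega> k then u N n \<omega> else 1) \<le> 1" for k
      proof -
        obtain n where "n \<in> E \<omega> k" using cl[of k \<omega>] by (auto simp: E_def)
        then have "(if n \<in> E \<omega> k then u N n \<omega> else 1) \<le> 1" using bound[of N n \<omega>] by auto
        moreover have "bdd_below (range (\<lambda>n. if n \<in> E \<omega> k then u N n \<omega> else 1))"
        proof (intro bdd_belowI2[of _ "-1"])
          fix m show "- 1 \<le> (if m \<in> E \<omega> k then u N m \<omega> else 1)" using bound[of N m \<omega>] by auto
        qed
        ultimately show ?thesis by (intro cINF_lower2[where x = n]) auto
      qed
      then show "bdd_above (range (\<lambda>k. INF n. if n \<in> E \<omega> k then u N n \<omega> else 1))"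
        by (intro bdd_aboveI[of _ 1]) auto
    qed measurable
    have dec: "decseq (E \<omega>)" for \<omega>
    proof (rule decseq_SucI)
      fix k
      have "1 / real (Suc (Suc k)) \<le> 1 / real (Suc k)" by (simp add: frac_le)
      then have "x < 1 / real (Suc k)" if "x < 1 / real (Suc (Suc k))" for x
        using that by (rule order.strict_trans2[rotated])
      then show "E \<omega> (Suc k) \<subseteq> E \<omega> k" unfolding E_def by (blast intro: Suc_leD)
    qed
    have ne: "E \<omega> k \<noteq> {}" for \<omega> k using cl[of k \<omega>] by (auto simp: E_def)
    have "\<exists>n\<ge>k. \<forall>j<Suc N. \<bar>u j n \<omega> - (l(N := y)) j \<omega>\<bar> < 1 / Suc k" for \<omega> k
    proof -
      have "\<exists>n\<in>E \<omega> k. \<bar>u N n \<omega> - y \<omega>\<bar> < 1 / Suc k"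
        unfolding y_def by (rule SUP_INF_cluster_point[OF dec ne bound]) simp
      then obtain n where "n \<in> E \<omega> k" "\<bar>u N n \<omega> - y \<omega>\<bar> < 1 / Suc k" by blast
      then show ?thesis by (intro exI[of _ n]) (auto simp: E_def less_Suc_eq)
    qed
    then show ?case using l y by (intro exI[of _ "l(N := y)"]) auto
  qed
  then obtain l where l: "\<And>j. j < N \<Longrightarrow> l j \<in> borel_measurable (G j)"
    and cl: "\<And>\<omega> k. \<exists>n\<ge>k. \<forall>j<N. \<bar>u j n \<omega> - l j \<omega>\<bar> < 1 / Suc k" by blast
  have "\<exists>\<phi>. filterlim \<phi> at_top sequentially \<and> (\<forall>j<N. (\<lambda>k. u j (\<phi> k) \<omega>) \<longlonglongrightarrow> l j \<omega>)" for \<omega>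
  proof -
    obtain \<phi> where \<phi>: "\<And>k. k \<le> \<phi> k" "\<And>k j. j < N \<Longrightarrow> \<bar>u j (\<phi> k) \<omega> - l j \<omega>\<bar> < 1 / Suc k"
      using cl[of _ \<omega>] by metis
    have "filterlim \<phi> at_top sequentially"
      using \<phi>(1) by (intro filterlim_at_top_mono[OF filterlim_ident]) auto
    moreover have "(\<lambda>k. u j (\<phi> k) \<omega>) \<longlonglongrightarrow> l j \<omega>" if "j < N" for j
    proof -
      have "(\<lambda>k. u j (\<phi> k) \<omega> - l j \<omega>) \<longlonglongrightarrow> 0"
      proof (rule Lim_null_comparison[OF _ LIMSEQ_Suc[OF lim_1_over_n]], intro always_eventually allI)
        show "norm (u j (\<phi> k) \<omega> - l j \<omega>) \<le> 1 / of_nat (Suc k)" for k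
          using \<phi>(2)[OF that, of k] by simp
      qed
      then show ?thesis by (simp add: LIM_zero_iff)
    qed
    ultimately show ?thesis by blast
  qed
  then show thesis using that l by blast
qed

section \<open>Ratios to the running scale\<close>

text \<open>
  \<open>past_scale a j\<close> is the \<open>r\<^sub>j\<close> of the outline above. If \<open>l j = a j / past_scale a (Suc j)\<close> for all \<open>j\<close>,
  then \<open>rescale l t s = a s / past_scale a t\<close> for \<open>t \<le> Suc s\<close>. Where some \<open>\<bar>l i\<bar> = 1\<close> with \<open>t \<le> i \<le> s\<close>,
  division by zero makes \<open>rescale l t s\<close> vanish.
\<close>

definition past_scale :: "(nat \<Rightarrow> real) \<Rightarrow> nat \<Rightarrow> real" where
  "past_scale a j = 1 + (\<Sum>i<j. \<bar>a i\<bar>)"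

definition rescale :: "(nat \<Rightarrow> real) \<Rightarrow> nat \<Rightarrow> nat \<Rightarrow> real" where
  "rescale l t s = l s / (\<Prod>i\<in>{t..<Suc s}. 1 - \<bar>l i\<bar>)"

lemma past_scale_ge_1: "1 \<le> past_scale a j"
  by (simp add: past_scale_def sum_nonneg)

lemma abs_le_past_scale: "i < j \<Longrightarrow> \<bar>a i\<bar> \<le> past_scale a j"
  using member_le_sum[of i "{..<j}" "\<lambda>i. \<bar>a i\<bar>"] by (simp add: past_scale_def)

lemma past_scale_ratio:
  "past_scale a j / past_scale a (Suc j) = 1 - \<bar>a j / past_scale a (Suc j)\<bar>"
  using past_scale_ge_1[of a "Suc j"]
  by (simp add: abs_divide field_simps) (simp add: past_scale_def)

text \<open>The ratios of \<open>past_scale_ratio\<close> telescope.\<close>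

lemma past_scale_prod:
  assumes "t \<le> s"
  shows "past_scale a s * (\<Prod>i\<in>{t..<s}. 1 - \<bar>a i / past_scale a (Suc i)\<bar>) = past_scale a t"
  using assms
proof (induction s rule: dec_induct)
  case base
  then show ?case by simp
next
  case (step s)
  have "past_scale a (Suc s) \<noteq> 0" using past_scale_ge_1[of a "Suc s"] by simp
  then have "past_scale a (Suc s) * (1 - \<bar>a s / past_scale a (Suc s)\<bar>) = past_scale a s"
    by (simp only: past_scale_ratio[symmetric]) simp
  then show ?case
    using step by (simp only: prod.atLeastLessThan_Suc mult.commute[of "prod _ _"] mult.assoc[symmetric])
qed

text \<open>The quotient is \<open>a k s / past_scale (a k) (Suc s)\<close> divided by
  \<open>past_scale (a k) t / past_scale (a k) (Suc s)\<close>, and the latter is a product of terms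
  \<open>1 - \<bar>?u k i\<bar>\<close>, whose limit is nonzero. For \<open>t = Suc s\<close> the
  product is empty and the limit is \<open>l s\<close>.\<close>

lemma tendsto_rescale:
  fixes a :: "nat \<Rightarrow> nat \<Rightarrow> real"
  assumes lim: "\<And>j. j < N \<Longrightarrow> (\<lambda>k. a k j / past_scale (a k) (Suc j)) \<longlonglongrightarrow> l j"
    and "t \<le> Suc s" "s < N" and l: "\<And>i. t \<le> i \<Longrightarrow> i \<le> s \<Longrightarrow> \<bar>l i\<bar> < 1"
  shows "(\<lambda>k. a k s / past_scale (a k) t) \<longlonglongrightarrow> rescale l t s"
proof -
  let ?u = "\<lambda>k j. a k j / past_scale (a k) (Suc j)"
  have eq: "a k s / past_scale (a k) t = ?u k s / (\<Prod>i\<in>{t..<Suc s}. 1 - \<bar>?u k i\<bar>)" for k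
    using past_scale_prod[OF \<open>t \<le> Suc s\<close>, of "a k"] past_scale_ge_1[of "a k" "Suc s"]
    by (metis divide_divide_eq_left)
  have "(\<Prod>i\<in>{t..<Suc s}. 1 - \<bar>l i\<bar>) \<noteq> 0"
    using l by (fastforce simp del: prod.op_ivl_Suc)
  then show ?thesis
    unfolding eq rescale_def using assms by (intro tendsto_intros lim) auto
qed

text \<open>The ratio is 1 minus a quantity tending to \<open>\<bar>l\<bar> = 1\<close>. Since its
  numerator is at least 1, it dominates the reciprocal of its denominator, which therefore
  explodes.\<close>

lemma past_scale_at_top:
  fixes a :: "nat \<Rightarrow> nat \<Rightarrow> real"
  assumes "(\<lambda>k. a k t / past_scale (a k) (Suc t)) \<longlonglongrightarrow> l" "\<bar>l\<bar> = 1"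
  shows "(\<lambda>k. past_scale (a k) t / past_scale (a k) (Suc t)) \<longlonglongrightarrow> 0"
    and "filterlim (\<lambda>k. past_scale (a k) (Suc t)) at_top sequentially"
proof -
  show *: "(\<lambda>k. past_scale (a k) t / past_scale (a k) (Suc t)) \<longlonglongrightarrow> 0"
    unfolding past_scale_ratio
    using tendsto_diff[OF tendsto_const[of 1] tendsto_rabs[OF assms(1)]] assms(2) by simp
  have pos: "0 < past_scale (a k) j" for k j using past_scale_ge_1[of "a k" j] by linarith
  have "(\<lambda>k. inverse (past_scale (a k) (Suc t))) \<longlonglongrightarrow> 0"
    by (rule Lim_null_comparison[OF _ *])
      (use past_scale_ge_1 pos in \<open>auto simp: divide_simps less_imp_le abs_of_pos\<close>)
  then have "filterlim (\<lambda>k. inverse (inverse (past_scale (a k) (Suc t)))) at_top sequentially"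
    by (rule filterlim_inverse_at_top) (use pos in simp)
  then show "filterlim (\<lambda>k. past_scale (a k) (Suc t)) at_top sequentially" by simp
qed

section \<open>Chronological coordinates and closedness of the superhedgeable claims\<close>

lemma obtain_sorted_enumeration:
  fixes key :: "'a::finite \<Rightarrow> 'b::linorder"
  obtains e :: "nat \<Rightarrow> 'a" where "bij_betw e {..<CARD('a)} UNIV"
    and "\<And>i j. i \<le> j \<Longrightarrow> j < CARD('a) \<Longrightarrow> key (e i) \<le> key (e j)"
proof -
  obtain xs :: "'a list" where xs: "set xs = UNIV" "distinct xs"
    using finite_distinct_list[of "UNIV :: 'a set"] finite by blast
  define ys where "ys = sort_key key xs"
  have ys: "set ys = UNIV" "distinct ys" "sorted (map key ys)" using xs by (auto simp: ys_def)
  have len: "length ys = CARD('a)" using distinct_card[OF ys(2)] ys(1) by simp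
  show thesis
  proof (rule that)
    show "bij_betw ((!) ys) {..<CARD('a)} UNIV"
      by (rule bij_betw_nth) (use ys len in auto)
    show "key (ys ! i) \<le> key (ys ! j)" if "i \<le> j" "j < CARD('a)" for i j
      using sorted_nth_mono[OF ys(3) that(1)] that len by simp
  qed
qed

theorem theorem4p13:
  fixes M :: "'w measure"
    and F :: "nat \<Rightarrow> 'w measure"
    and V :: "'w \<Rightarrow> (real^'d)^('t::{finite,linorder}) \<Rightarrow> ereal"
  assumes "prob_space M"
    and "filtration_upto M CARD('t) F"
    and "market_model M V"
    and "NA M F V"
  shows "closed_in_probability M (superhedgeable M F V)"
proof -
  interpret prob_space M by fact
  note filt = assms(2)[unfolded filtration_upto_def]
  let ?N = "CARD('t \<times> 'd)"
  obtain e :: "nat \<Rightarrow> 't \<times> 'd" where e: "bij_betw e {..<?N} UNIV"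
    and e_mono: "\<And>i j. i \<le> j \<Longrightarrow> j < ?N \<Longrightarrow> date (fst (e i)) \<le> date (fst (e j))"
    using obtain_sorted_enumeration[of "\<lambda>p::'t \<times> 'd. date (fst p)"] by blast
  define idx where "idx = the_inv_into {..<?N} e"
  have idx: "idx p < ?N" "e (idx p) = p" for p
    using e the_inv_into_into[of e "{..<?N}" p] f_the_inv_into_f[of e "{..<?N}" p]
    by (auto simp: idx_def bij_betw_def)
  have idx_e: "idx (e j) = j" if "j < ?N" for j
    using e that by (simp add: idx_def the_inv_into_f_f bij_betw_def)
  \<comment> \<open>Coordinates of the same date share one sigma-algebra, so their mutual order is
    immaterial.\<close>
  define G where "G j = F (date (fst (e j)))" for j
  define vec :: "(nat \<Rightarrow> real) \<Rightarrow> (real^'d)^('t::{finite,linorder})"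
    where "vec h = (\<chi> \<tau> i. h (idx (\<tau>, i)))" for h

  have date_less: "date \<tau> < CARD('t)" for \<tau> :: 't
    using date_bij_betw by (auto simp: bij_betw_def)
  have sub: "subalgebra (G j) (G i)" if "i \<le> j" "j < ?N" for i j
  proof -
    have "date (fst (e i)) \<le> CARD('t)" "date (fst (e j)) \<le> CARD('t)"
      using date_less less_imp_le by blast+
    then show ?thesis
      using filt e_mono[OF that] by (auto simp: subalgebra_def G_def)
  qed
  have vec_strategy: "(\<lambda>\<omega>. vec (\<lambda>j. h j \<omega>)) \<in> strategies F"
    if h: "\<And>j. j < ?N \<Longrightarrow> h j \<in> borel_measurable (G j)" for h :: "nat \<Rightarrow> 'w \<Rightarrow> real"
    unfolding strategies_def
  proof (intro CollectI allI)
    fix \<tau> :: 't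
    have "h (idx (\<tau>, i)) \<in> borel_measurable (F (date \<tau>))" for i
      using h[OF idx(1), of "(\<tau>, i)"] by (simp add: G_def idx)
    then show "(\<lambda>\<omega>. vec (\<lambda>j. h j \<omega>) $ \<tau>) \<in> borel_measurable (F (date \<tau>))"
      by (subst borel_measurable_euclidean_space) (auto simp: Basis_vec_def vec_def inner_axis)
  qed
  have vec_tendsto: "(\<lambda>k. vec (b k)) \<longlonglongrightarrow> vec h" if "\<And>j. j < ?N \<Longrightarrow> (\<lambda>k. b k j) \<longlonglongrightarrow> h j"
    for b :: "nat \<Rightarrow> nat \<Rightarrow> real" and h
    by (intro vec_tendstoI) (simp add: vec_def that[OF idx(1)])
  have vec_scale: "r *\<^sub>R vec h = vec (\<lambda>j. r * h j)" for r h
    by (simp add: vec_def vec_eq_iff)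

  show ?thesis
    unfolding closed_in_probability_def
  proof (intro allI ballI impI, elim conjE)
    fix X Y assume Y: "Y \<in> borel_measurable M"
      and XC: "\<forall>n. X n \<in> superhedgeable M F V" and lim: "tendsto_in_probability M X Y"
    have "X n \<in> borel_measurable M" for n using XC by (auto simp: superhedgeable_def)
    then obtain \<psi> :: "nat \<Rightarrow> nat" where \<psi>: "AE \<omega> in M. (\<lambda>n. X (\<psi> n) \<omega>) \<longlonglongrightarrow> Y \<omega>"
      using tendsto_in_probability_AE_subseq[OF \<open>prob_space M\<close> _ Y lim] by blast
    have "\<exists>\<theta>\<in>strategies F. AE \<omega> in M. ereal (X (\<psi> n) \<omega>) \<le> V \<omega> (\<theta> \<omega>)" for n
      using XC by (auto simp: superhedgeable_def)
    then obtain \<theta> where \<theta>: "\<And>n. \<theta> n \<in> strategies F"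
      and hedge: "\<And>n. AE \<omega> in M. ereal (X (\<psi> n) \<omega>) \<le> V \<omega> (\<theta> n \<omega>)"
      by metis
    define a where "a \<omega> n j = \<theta> n \<omega> $ fst (e j) $ snd (e j)" for \<omega> n j
    have vec_a: "vec (a \<omega> n) = \<theta> n \<omega>" for \<omega> n
      by (simp add: vec_def vec_eq_iff a_def idx)
    \<comment> \<open>Earlier coordinates \<open>i < j\<close> are included because the denominator
      of \<open>u j\<close> involves them.\<close>
    have a_meas: "(\<lambda>\<omega>. a \<omega> n i) \<in> borel_measurable (G j)" if "i \<le> j" "j < ?N" for n i j
    proof (rule measurable_from_subalg[OF sub[OF that]])
      have "(\<lambda>\<omega>. \<theta> n \<omega> $ fst (e i)) \<in> borel_measurable (G i)"
        using \<theta>[of n] by (auto simp: strategies_def G_def)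
      from borel_measurable_inner[OF this borel_measurable_const[of "axis (snd (e i)) 1"]]
      show "(\<lambda>\<omega>. a \<omega> n i) \<in> borel_measurable (G i)" by (simp add: a_def inner_axis)
    qed
    define u where "u j n \<omega> = a \<omega> n j / past_scale (a \<omega> n) (Suc j)" for j n \<omega>
    have u_meas: "u j n \<in> borel_measurable (G j)" if "j < ?N" for j n
      unfolding u_def past_scale_def using a_meas that
      by (intro borel_measurable_divide borel_measurable_add borel_measurable_sum borel_measurable_abs)
        auto
    have u_bound: "\<bar>u j n \<omega>\<bar> \<le> 1" for j n \<omega>
      using abs_le_past_scale[of j "Suc j" "a \<omega> n"] past_scale_ge_1[of "a \<omega> n" "Suc j"]
      by (simp add: u_def abs_divide)
    obtain l where l_meas: "\<And>j. j < ?N \<Longrightarrow> l j \<in> borel_measurable (G j)"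
      and cluster: "\<And>\<omega>. \<exists>\<phi>. filterlim \<phi> at_top sequentially \<and>
          (\<forall>j<?N. (\<lambda>k. u j (\<phi> k) \<omega>) \<longlonglongrightarrow> l j \<omega>)"
      using adapted_cluster_point[of ?N G u, OF sub u_meas u_bound] by blast
    have l_le: "\<bar>l j \<omega>\<bar> \<le> 1" if j: "j < ?N" for j \<omega>
    proof -
      obtain \<phi> where "(\<lambda>k. u j (\<phi> k) \<omega>) \<longlonglongrightarrow> l j \<omega>" using cluster[of \<omega>] j by blast
      from tendsto_rabs[OF this] show ?thesis
        by (rule tendsto_upperbound) (auto simp: u_bound)
    qed
    have l_meas': "l i \<in> borel_measurable (G j)" if "i \<le> j" "j < ?N" for i j
      by (rule measurable_from_subalg[OF sub[OF that] l_meas]) (use that in simp)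
    have rescale_meas: "(\<lambda>\<omega>. rescale (\<lambda>j. l j \<omega>) t s) \<in> borel_measurable (G s)"
      if "s < ?N" for t s
    proof -
      have [measurable]: "l i \<in> borel_measurable (G s)" if "i \<in> insert s {t..<Suc s}" for i
        using that \<open>s < ?N\<close> by (intro l_meas') auto
      show ?thesis unfolding rescale_def
        by (intro borel_measurable_divide borel_measurable_prod) measurable
    qed
    have good: "AE \<omega> in M. \<omega> \<in> space M \<and> V \<omega> 0 = 0 \<and> (\<lambda>n. X (\<psi> n) \<omega>) \<longlonglongrightarrow> Y \<omega> \<and>
        (\<forall>n. ereal (X (\<psi> n) \<omega>) \<le> V \<omega> (\<theta> n \<omega>))"
    proof -
      have "AE \<omega> in M. \<forall>n. ereal (X (\<psi> n) \<omega>) \<le> V \<omega> (\<theta> n \<omega>)"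
        using hedge by (simp add: AE_all_countable)
      moreover have "AE \<omega> in M. V \<omega> 0 = 0" using assms(3) by (simp add: market_model_def)
      ultimately show ?thesis using \<psi> AE_space by eventually_elim simp
    qed

    \<comment> \<open>Downward induction from the empty range at \<open>t = ?N\<close>; in the step,
      coordinates from \<open>Suc t\<close> on are already known not to explode.\<close>
    have "AE \<omega> in M. \<forall>i\<in>{t..<?N}. \<bar>l i \<omega>\<bar> < 1" if "t \<le> ?N" for t
      using that
    proof (induction t rule: inc_induct)
      case base
      show ?case by simp
    next
      case (step t)
      \<comment> \<open>The candidate for contradicting (NA): the limit of the strategies divided by
        \<open>past_scale\<close> at \<open>Suc t\<close>, on the event where coordinate
        \<open>t\<close> explodes. This event lies in \<open>G t\<close>, and the coordinates before
        \<open>t\<close> are 0, so \<open>z\<close> is adapted.\<close>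
      define z where "z s \<omega> = (if t \<le> s \<and> \<bar>l t \<omega>\<bar> = 1 then rescale (\<lambda>j. l j \<omega>) (Suc t) s else 0)"
        for s \<omega>
      have z_meas: "z s \<in> borel_measurable (G s)" if "s < ?N" for s
      proof (cases "t \<le> s")
        case True
        have [measurable]: "l t \<in> borel_measurable (G s)"
          "(\<lambda>\<omega>. rescale (\<lambda>j. l j \<omega>) (Suc t) s) \<in> borel_measurable (G s)"
          using True that by (auto intro: l_meas' rescale_meas)
        show ?thesis unfolding z_def using True by simp
      qed (simp add: z_def[abs_def])
      have "AE \<omega> in M. 0 \<le> recession V \<omega> (vec (\<lambda>j. z j \<omega>))"
        using good step.IH
      proof eventually_elim
        case (elim \<omega>)
        show ?case
        proof (cases "\<bar>l t \<omega>\<bar> = 1")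
          case False
          \<comment> \<open>Off the explosion event the candidate is 0, and
            \<open>V \<omega> 0 = 0\<close> along any scales gives a nonnegative recession
            value.\<close>
          then have "vec (\<lambda>j. z j \<omega>) = 0" by (simp add: vec_def z_def vec_eq_iff)
          moreover have "0 \<le> recession V \<omega> 0"
            using elim
            by (intro recession_nonneg[where \<delta> = real and \<zeta> = "\<lambda>_. 0" and c = "\<lambda>_. 0"])
              (auto intro: filterlim_real_sequentially simp: zero_ereal_def[symmetric])
          ultimately show ?thesis by simp
        next
          case True
          obtain \<phi> where \<phi>: "filterlim \<phi> at_top sequentially"
            "\<And>j. j < ?N \<Longrightarrow> (\<lambda>k. u j (\<phi> k) \<omega>) \<longlonglongrightarrow> l j \<omega>" using cluster by blast
          let ?a = "\<lambda>k. a \<omega> (\<phi> k)"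
          have u_lim: "(\<lambda>k. ?a k j / past_scale (?a k) (Suc j)) \<longlonglongrightarrow> l j \<omega>" if "j < ?N" for j
            using \<phi>(2)[OF that] by (simp add: u_def)
          have ps: "0 < past_scale (?a k) j" for k j
            using past_scale_ge_1[of "?a k" j] by linarith
          note top = past_scale_at_top[OF u_lim[OF \<open>t < ?N\<close>] True]
          show ?thesis
          proof (rule recession_nonneg)
            show "filterlim (\<lambda>k. past_scale (?a k) (Suc t)) at_top sequentially" by (rule top)
            show "(\<lambda>k. vec (\<lambda>j. ?a k j / past_scale (?a k) (Suc t))) \<longlonglongrightarrow> vec (\<lambda>j. z j \<omega>)"
            proof (rule vec_tendsto)
              fix s assume s: "s < ?N"
              show "(\<lambda>k. ?a k s / past_scale (?a k) (Suc t)) \<longlonglongrightarrow> z s \<omega>"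
              proof (cases "t \<le> s")
                case t: True
                \<comment> \<open>The induction hypothesis supplies
                  \<open>\<bar>l i \<omega>\<bar> < 1\<close> for \<open>Suc t \<le> i\<close>; for
                  \<open>s = t\<close> the range is empty.\<close>
                have "(\<lambda>k. ?a k s / past_scale (?a k) (Suc t)) \<longlonglongrightarrow> rescale (\<lambda>j. l j \<omega>) (Suc t) s"
                  by (rule tendsto_rescale[where N = ?N]) (use u_lim s t elim in auto)
                then show ?thesis using True t by (simp add: z_def)
              next
                case False
                \<comment> \<open>A coordinate before \<open>t\<close> is bounded by
                  \<open>past_scale\<close> at \<open>t\<close>, which is negligible against
                  \<open>past_scale\<close> at \<open>Suc t\<close>.\<close>
                have "(\<lambda>k. ?a k s / past_scale (?a k) (Suc t)) \<longlonglongrightarrow> 0"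
                  by (rule Lim_null_comparison[OF _ top(1)])
                    (use False ps abs_le_past_scale in \<open>auto simp: abs_of_pos divide_right_mono less_imp_le\<close>)
                then show ?thesis using False by (simp add: z_def)
              qed
            qed
            show "ereal (X (\<psi> (\<phi> k)) \<omega>)
              \<le> V \<omega> (past_scale (?a k) (Suc t) *\<^sub>R vec (\<lambda>j. ?a k j / past_scale (?a k) (Suc t)))" for k
              using elim ps[of k "Suc t"] by (simp add: vec_scale vec_a)
            have "(\<lambda>k. X (\<psi> (\<phi> k)) \<omega>) \<longlonglongrightarrow> Y \<omega>"
              using elim \<phi>(1) by (auto intro: filterlim_compose)
            then show "(\<lambda>k. X (\<psi> (\<phi> k)) \<omega> / past_scale (?a k) (Suc t)) \<longlonglongrightarrow> 0"
              by (rule real_tendsto_divide_at_top) (rule top)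
          qed
        qed
      qed
      then have "AE \<omega> in M. vec (\<lambda>j. z j \<omega>) = 0"
        using assms(4) vec_strategy[OF z_meas] by (auto simp: NA_def)
      with step.IH show ?case
      proof eventually_elim
        case (elim \<omega>)
        have "z t \<omega> = vec (\<lambda>j. z j \<omega>) $ fst (e t) $ snd (e t)"
          using \<open>t < ?N\<close> by (simp add: vec_def idx_e)
        also have "\<dots> = 0" using elim by simp
        \<comment> \<open>On the explosion event the product in \<open>rescale\<close> is empty at
          coordinate \<open>t\<close>, so \<open>z t \<omega> = l t \<omega>\<close>, which is
          nonzero.\<close>
        finally have "\<bar>l t \<omega>\<bar> \<noteq> 1" by (auto simp: z_def rescale_def)
        then have "\<bar>l t \<omega>\<bar> < 1" using l_le[OF \<open>t < ?N\<close>, of \<omega>] by linarith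
        then show ?case using elim by (auto simp: le_less Suc_le_eq)
      qed
    qed
    from this[of 0] have l_less: "AE \<omega> in M. \<forall>i<?N. \<bar>l i \<omega>\<bar> < 1" by (simp add: Ball_def)

    have "AE \<omega> in M. ereal (Y \<omega>) \<le> V \<omega> (vec (rescale (\<lambda>j. l j \<omega>) 0))"
      using good l_less
    proof eventually_elim
      case (elim \<omega>)
      obtain \<phi> where \<phi>: "filterlim \<phi> at_top sequentially"
        "\<And>j. j < ?N \<Longrightarrow> (\<lambda>k. u j (\<phi> k) \<omega>) \<longlonglongrightarrow> l j \<omega>" using cluster by blast
      \<comment> \<open>Since \<open>past_scale\<close> at 0 equals 1, rescaling from 0 recovers the
        limit of the strategies themselves.\<close>
      have "(\<lambda>k. a \<omega> (\<phi> k) s / past_scale (a \<omega> (\<phi> k)) 0) \<longlonglongrightarrow> rescale (\<lambda>j. l j \<omega>) 0 s"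
        if "s < ?N" for s
        by (rule tendsto_rescale[where N = ?N]) (use \<phi> that elim in \<open>auto simp: u_def\<close>)
      then have "(\<lambda>k. \<theta> (\<phi> k) \<omega>) \<longlonglongrightarrow> vec (rescale (\<lambda>j. l j \<omega>) 0)"
        unfolding vec_a[symmetric] by (intro vec_tendsto) (simp add: past_scale_def)
      moreover have "(\<lambda>k. X (\<psi> (\<phi> k)) \<omega>) \<longlonglongrightarrow> Y \<omega>"
        using elim \<phi>(1) by (auto intro: filterlim_compose)
      moreover have "normal_integrand M V" "\<omega> \<in> space M"
        using assms(3) elim by (simp_all add: market_model_def)
      ultimately show ?case
        using normal_integrand_usc[of M V \<omega> "\<lambda>k. \<theta> (\<phi> k) \<omega>" _ "\<lambda>k. X (\<psi> (\<phi> k)) \<omega>"] elim by blast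
    qed
    moreover have "(\<lambda>\<omega>. vec (rescale (\<lambda>j. l j \<omega>) 0)) \<in> strategies F"
      using vec_strategy[of "\<lambda>s \<omega>. rescale (\<lambda>j. l j \<omega>) 0 s", OF rescale_meas] by simp
    ultimately show "Y \<in> superhedgeable M F V"
      unfolding superhedgeable_def mem_Collect_eq using Y by (intro conjI bexI)
  qed
qed

end
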